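(* Let $k$ be a positive integer, let $\mathcal{A}$ be a monotone family of subsets of $[n]$ with all minterms of size at most $k$, and let $p\in[0,1]$ with $kp\le 1$. If $\mathbb{E}^*_p(\mathcal{A})=1$, then $\mu_{kp}(\mathcal{A})>1/e$.
   Context: Let $[n]=\{0,1,\ldots,n\}$ and let $P([n])$ be its power set. For $p\in[0,1]$, $\mu_p(\mathcal{A})$ is the probability that a random subset of $[n]$, containing each element independently with probability $p$, belongs to $\mathcal{A}\subseteq P([n])$. A family $\mathcal{A}$ is monotone if $A\in\mathcal{A}$ and $A\subset B\subseteq [n]$ imply $B\in\mathcal{A}$. A minterm of $\mathcal{A}$ is a member of $\mathcal{A}$ minimal with respect to inclusion; let $\mathcal{M}$ be the set of minterms of $\mathcal{A}$. The fractional expectation of $\mathcal{A}$ with respect to $\mu_p$ is $$\mathbb{E}^*_p(\mathcal{A})=\min \sum_{B\subseteq[n]}\beta(B)\,p^{|B|},$$ where the minimum is over all functions $\beta:P([n])\to\mathbb{R}^{\ge 0}$ such that $\sum_{B\subseteq A}\beta(B)\ge 1$ for all $A\in\mathcal{M}$. (The empty set is allowed as $B$; $p^0=1$.) *)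

theory Defs
  imports "HOL-Probability.Probability"
begin

definition random_subset :: "nat \<Rightarrow> real \<Rightarrow> nat set pmf" where
  "random_subset n p =
     map_pmf (\<lambda>f. {i \<in> {0..n}. f i}) (Pi_pmf {0..n} False (\<lambda>_. bernoulli_pmf p))"

definition mu :: "nat \<Rightarrow> real \<Rightarrow> nat set set \<Rightarrow> real" where
  "mu n p \<A> = measure_pmf.prob (random_subset n p) \<A>"

definition monotone_family :: "nat \<Rightarrow> nat set set \<Rightarrow> bool" where
  "monotone_family n \<A> \<longleftrightarrow> \<A> \<subseteq> Pow {0..n} \<and>
     (\<forall>A B. A \<in> \<A> \<longrightarrow> A \<subset> B \<longrightarrow> B \<subseteq> {0..n} \<longrightarrow> B \<in> \<A>)"

definition minterms :: "nat set set \<Rightarrow> nat set set" where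
  "minterms \<A> = {A \<in> \<A>. \<not> (\<exists>B \<in> \<A>. B \<subset> A)}"

definition fractional_cover :: "nat \<Rightarrow> nat set set \<Rightarrow> (nat set \<Rightarrow> real) \<Rightarrow> bool" where
  "fractional_cover n \<A> \<beta> \<longleftrightarrow>
     (\<forall>B \<in> Pow {0..n}. \<beta> B \<ge> 0) \<and> (\<forall>A \<in> minterms \<A>. (\<Sum>B\<in>Pow A. \<beta> B) \<ge> 1)"

definition cover_cost :: "nat \<Rightarrow> real \<Rightarrow> (nat set \<Rightarrow> real) \<Rightarrow> real" where
  "cover_cost n p \<beta> = (\<Sum>B\<in>Pow {0..n}. \<beta> B * p ^ card B)"

(* The infimum is attained for p >= 0, see frac_expectation_attained, so it is a minimum. *)
definition frac_expectation :: "nat \<Rightarrow> real \<Rightarrow> nat set set \<Rightarrow> real" where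
  "frac_expectation n p \<A> = Inf (cover_cost n p ` {\<beta>. fractional_cover n \<A> \<beta>})"

lemma cover_cost_attains_min:
  assumes "\<A> \<subseteq> Pow {0..n}" and "p \<ge> 0"
  shows "\<exists>\<beta>. fractional_cover n \<A> \<beta> \<and>
           (\<forall>\<gamma>. fractional_cover n \<A> \<gamma> \<longrightarrow> cover_cost n p \<beta> \<le> cover_cost n p \<gamma>)"
proof -
  define M where "M = minterms \<A>"
  define K :: "(nat set \<Rightarrow> real) set" where "K = PiE UNIV (\<lambda>_. {0..1})"
  define C where "C = K \<inter> (\<Inter>A\<in>M. {\<beta>. (\<Sum>B\<in>Pow A. \<beta> B) \<ge> 1})"
  have finM: "finite A" "A \<subseteq> {0..n}" if "A \<in> M" for A
    using that assms(1) finite_subset[of A "{0..n}"] by (auto simp: M_def minterms_def)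
  have "compactin (product_topology (\<lambda>_. euclidean) UNIV) K"
    unfolding K_def by (subst compactin_PiE) auto
  then have K: "compact K"
    by (simp add: euclidean_product_topology)
  have "closed {\<beta>::nat set \<Rightarrow> real. (\<Sum>B\<in>Pow A. \<beta> B) \<ge> 1}" for A
    by (intro closed_Collect_le continuous_intros continuous_on_product_coordinates)
  then have "compact C"
    unfolding C_def using K by (intro compact_Int_closed closed_INT) auto
  moreover have "(\<lambda>_. 1) \<in> C"
    using finM(1) by (auto simp: C_def K_def card_Pow)
  moreover have "continuous_on C (cover_cost n p)"
  proof -
    have "continuous_on C (\<lambda>\<beta>. \<Sum>B\<in>Pow {0..n}. \<beta> B * p ^ card B)"
      by (intro continuous_intros continuous_on_subset[OF continuous_on_product_coordinates]) auto
    then show ?thesis by (simp add: cover_cost_def [abs_def])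
  qed
  ultimately obtain \<beta> where \<beta>: "\<beta> \<in> C" "\<And>\<gamma>. \<gamma> \<in> C \<Longrightarrow> cover_cost n p \<beta> \<le> cover_cost n p \<gamma>"
    using continuous_attains_inf[of C "cover_cost n p"] by blast
  have "fractional_cover n \<A> \<beta>"
    using \<beta>(1) by (auto simp: C_def K_def fractional_cover_def M_def PiE_def Pi_def)
  moreover have "cover_cost n p \<beta> \<le> cover_cost n p \<gamma>" if \<gamma>: "fractional_cover n \<A> \<gamma>" for \<gamma>
  proof -
    define \<delta> where "\<delta> B = (if B \<subseteq> {0..n} then min (\<gamma> B) 1 else 0)" for B
    have nn: "\<gamma> B \<ge> 0" if "B \<subseteq> {0..n}" for B
      using \<gamma> that by (auto simp: fractional_cover_def)
    have \<delta>0: "\<delta> B \<ge> 0" for B using nn by (auto simp: \<delta>_def)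
    have "(\<Sum>B\<in>Pow A. \<delta> B) \<ge> 1" if A: "A \<in> M" for A
    proof (cases "\<exists>B\<in>Pow A. \<gamma> B \<ge> 1")
      case True
      then obtain B where B: "B \<in> Pow A" "\<gamma> B \<ge> 1" by blast
      then have "\<delta> B = 1" using finM[OF A] by (auto simp: \<delta>_def)
      moreover have "\<delta> B \<le> (\<Sum>B\<in>Pow A. \<delta> B)"
        using B \<delta>0 finM[OF A] by (intro member_le_sum) auto
      ultimately show ?thesis by simp
    next
      case False
      then have "(\<Sum>B\<in>Pow A. \<delta> B) = (\<Sum>B\<in>Pow A. \<gamma> B)"
        using finM(2)[OF A] by (intro sum.cong refl) (auto simp: \<delta>_def not_le intro!: min.absorb1 less_imp_le)
      then show ?thesis using \<gamma> A by (simp add: fractional_cover_def M_def)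
    qed
    then have "\<delta> \<in> C" using \<delta>0 by (auto simp: C_def K_def \<delta>_def nn)
    then have "cover_cost n p \<beta> \<le> cover_cost n p \<delta>" by (rule \<beta>(2))
    also have "\<dots> \<le> cover_cost n p \<gamma>"
      unfolding cover_cost_def using assms(2)
      by (intro sum_mono mult_right_mono) (auto simp: \<delta>_def)
    finally show ?thesis .
  qed
  ultimately show ?thesis by blast
qed

lemma frac_expectation_attained:
  assumes "\<A> \<subseteq> Pow {0..n}" and "p \<ge> 0"
  obtains \<beta> where "fractional_cover n \<A> \<beta>" "frac_expectation n p \<A> = cover_cost n p \<beta>"
    "\<And>\<gamma>. fractional_cover n \<A> \<gamma> \<Longrightarrow> frac_expectation n p \<A> \<le> cover_cost n p \<gamma>"
proof -
  obtain \<beta> where \<beta>: "fractional_cover n \<A> \<beta>"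
    "\<And>\<gamma>. fractional_cover n \<A> \<gamma> \<Longrightarrow> cover_cost n p \<beta> \<le> cover_cost n p \<gamma>"
    using cover_cost_attains_min[OF assms] by blast
  then have "frac_expectation n p \<A> = cover_cost n p \<beta>"
    unfolding frac_expectation_def by (intro cInf_eq_minimum) auto
  with \<beta> that show ?thesis by simp
qed

end

theory Submission
  imports Defs
begin

text \<open>
  Put \<open>q = k p\<close>. For a probability distribution \<open>\<lambda>\<close> on the minterms, apply the second moment method
  to \<open>X(W) = \<Sum>A. \<lambda> A [A \<subseteq> W] / q ^ |A|\<close>: it has mean 1, vanishes off the family, and its second
  moment is the quadratic form \<open>Q(\<lambda>)\<close> with kernel \<open>(1/q) ^ |A \<inter> A'|\<close>, so the family has measure
  at least \<open>1 / Q(\<lambda>)\<close>. Linear programming duality is avoided by taking \<open>\<lambda>\<close> to minimise \<open>Q\<close> over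
  the simplex: the first-order conditions at the minimum say exactly that
  \<open>\<beta> S = (1/q - 1) ^ |S| \<lambda>{A. S \<subseteq> A} / Q(\<lambda>)\<close> is a fractional cover. Its cost is at most
  \<open>(1 + 1/k - p) ^ k / Q(\<lambda>)\<close> and at least 1, whence \<open>Q(\<lambda>) < e\<close>.
\<close>

section \<open>Minimising a quadratic form over a simplex\<close>

text \<open>A minimiser \<open>l\<close> exists by compactness. Moving it a distance
  \<open>t\<close> towards the vertex at \<open>a\<close> changes the form by
  \<open>2 * t * (R l a - Q l)\<close> up to a term of order t squared, so a negative first-order
  coefficient would contradict minimality.\<close>

lemma simplex_quadratic_form_minimizer:
  fixes K :: "'a \<Rightarrow> 'a \<Rightarrow> real"
  assumes fin: "finite M" and ne: "M \<noteq> {}"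
    and sym: "\<And>a b. K a b = K b a"
  obtains l where "\<And>a. a \<in> M \<Longrightarrow> l a \<ge> 0" "sum l M = 1"
    "\<And>a. a \<in> M \<Longrightarrow> (\<Sum>b\<in>M. \<Sum>c\<in>M. l b * l c * K b c) \<le> (\<Sum>b\<in>M. l b * K a b)"
proof -
  define Q where "Q l = (\<Sum>b\<in>M. \<Sum>c\<in>M. l b * l c * K b c)" for l :: "'a \<Rightarrow> real"
  define R where "R l a = (\<Sum>b\<in>M. l b * K a b)" for l :: "'a \<Rightarrow> real" and a
  \<comment> \<open>Coordinates outside \<open>M\<close> are only confined to the unit interval:
    this makes the full product compact, and neither \<open>Q\<close> nor the constraint depends on
    them.\<close>
  define C :: "('a \<Rightarrow> real) set" where "C = PiE UNIV (\<lambda>_. {0..1}) \<inter> {l. sum l M = 1}"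
  have "compactin (product_topology (\<lambda>_. euclidean) UNIV) (PiE UNIV (\<lambda>_::'a. {0..1::real}))"
    by (subst compactin_PiE) auto
  then have K: "compact (PiE UNIV (\<lambda>_::'a. {0..1::real}))"
    by (simp add: euclidean_product_topology)
  have "closed {l::'a \<Rightarrow> real. sum l M = 1}"
    by (intro closed_Collect_eq continuous_intros continuous_on_product_coordinates)
  then have "compact C"
    unfolding C_def using K by (intro compact_Int_closed)
  moreover obtain a0 where a0: "a0 \<in> M" using ne by blast
  then have "(\<lambda>a. if a = a0 then 1 else 0) \<in> C"
    using fin by (auto simp: C_def)
  moreover have "continuous_on C Q"
    unfolding Q_def
    by (intro continuous_intros continuous_on_subset[OF continuous_on_product_coordinates]) auto
  ultimately obtain l where l: "l \<in> C" "\<And>m. m \<in> C \<Longrightarrow> Q l \<le> Q m"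
    using continuous_attains_inf[of C Q] by blast
  have l01: "0 \<le> l a" "l a \<le> 1" for a
    using l(1) by (auto simp: C_def PiE_def Pi_def)
  have l1: "sum l M = 1" using l(1) by (simp add: C_def)
  have first_order: "Q l \<le> R l a" if a: "a \<in> M" for a
  proof (rule ccontr)
    assume "\<not> Q l \<le> R l a"
    then have d: "Q l - R l a > 0" by simp
    \<comment> \<open>The segment from \<open>l\<close> at \<open>t = 0\<close> to the vertex
      concentrated on \<open>a\<close> at \<open>t = 1\<close>.\<close>
    define m where "m t b = (1 - t) * l b + t * (if b = a then 1 else 0)" for t :: real and b
    have mC: "m t \<in> C" if "0 \<le> t" "t \<le> 1" for t
    proof -
      have "0 \<le> m t b" "m t b \<le> 1" for b
        unfolding m_def using that l01[of b]
        by (auto intro!: convex_bound_le mult_le_one)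
           (smt (verit) mult_left_le)+
      moreover have "sum (m t) M = 1"
        using a fin l1 by (simp add: m_def sum.distrib flip: sum_distrib_left)
      ultimately show ?thesis by (auto simp: C_def)
    qed
    have Qm: "Q (m t) = (1 - t)\<^sup>2 * Q l + 2 * t * (1 - t) * R l a + t\<^sup>2 * K a a" for t
    proof -
      have inner: "(\<Sum>c\<in>M. m t c * K b c) = (1 - t) * R l b + t * K a b" for b
      proof -
        have "(\<Sum>c\<in>M. m t c * K b c)
            = (\<Sum>c\<in>M. (1 - t) * (l c * K b c) + (if c = a then t * K b a else 0))"
          by (intro sum.cong) (auto simp: m_def algebra_simps)
        then show ?thesis
          using a fin sym[of b a] by (simp add: sum.distrib R_def flip: sum_distrib_left)
      qed
      have "Q (m t) = (\<Sum>b\<in>M. m t b * ((1 - t) * R l b + t * K a b))"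
        unfolding Q_def by (simp add: sum_distrib_left mult.assoc flip: inner)
      also have "\<dots> = (1 - t) * (\<Sum>b\<in>M. m t b * R l b) + t * (\<Sum>b\<in>M. m t b * K a b)"
        by (simp add: sum_distrib_left algebra_simps flip: sum.distrib)
      also have "(\<Sum>b\<in>M. m t b * R l b)
          = (\<Sum>b\<in>M. (1 - t) * (l b * R l b) + (if b = a then t * R l a else 0))"
        by (intro sum.cong) (auto simp: m_def algebra_simps)
      also have "\<dots> = (1 - t) * Q l + t * R l a"
        using a fin
        by (simp add: sum.distrib Q_def R_def sum_distrib_left mult.assoc)
      finally show ?thesis
        unfolding inner by (simp add: power2_eq_square algebra_simps)
    qed
    \<comment> \<open>The bound 1 keeps \<open>m t\<close> in the simplex. The quotient makes the
      quadratic term at most \<open>t * (Q l - R l a)\<close>, half of the linear gain, so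
      \<open>Q\<close> strictly drops; the summand 1 keeps the denominator positive.\<close>
    define t where "t = min 1 ((Q l - R l a) / (\<bar>Q l - 2 * R l a + K a a\<bar> + 1))"
    have t: "0 < t" "t \<le> 1"
      using d by (auto simp: t_def)
    have "t * (Q l - 2 * R l a + K a a) \<le> t * (\<bar>Q l - 2 * R l a + K a a\<bar> + 1)"
      using t by (intro mult_left_mono) auto
    also have "\<dots> \<le> Q l - R l a"
      by (subst pos_le_divide_eq[symmetric]) (auto simp: t_def)
    finally have "t * (t * (Q l - 2 * R l a + K a a)) \<le> t * (Q l - R l a)"
      using t by (intro mult_left_mono) auto
    moreover have "t * (Q l - R l a) > 0" using t d by simp
    moreover have "Q (m t) - Q l = t * (t * (Q l - 2 * R l a + K a a)) - 2 * (t * (Q l - R l a))"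
      by (simp add: Qm power2_eq_square algebra_simps)
    moreover have "Q l \<le> Q (m t)"
      using mC t by (intro l(2)) auto
    ultimately show False by linarith
  qed
  show ?thesis
    using that[of l] l01 l1 first_order by (simp add: Q_def R_def)
qed

text \<open>Expand the product of \<open>1 + x\<close> over the elements of \<open>A\<close>. With
  \<open>1 + x = 1 / q\<close> and \<open>A \<inter> B\<close> for \<open>A\<close>, this splits the
  kernel of the quadratic form into nonnegative contributions of single sets, from which the
  fractional cover is read off.\<close>

lemma sum_Pow_power_card:
  fixes x :: "'a::comm_semiring_1"
  assumes "finite A"
  shows "(\<Sum>S\<in>Pow A. x ^ card S) = (1 + x) ^ card A"
  using prod_add[OF assms, of "\<lambda>_. x" "\<lambda>_. 1"] by (simp add: add.commute)

section \<open>Random subsets and the second moment method\<close>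

lemma set_pmf_random_subset: "set_pmf (random_subset n q) \<subseteq> Pow {0..n}"
  by (auto simp: random_subset_def)

lemma finite_set_pmf_random_subset: "finite (set_pmf (random_subset n q))"
  by (rule finite_subset[OF set_pmf_random_subset]) simp

lemma prob_random_subset_superset:
  assumes "A \<subseteq> {0..n}" "0 \<le> q" "q \<le> 1"
  shows "measure_pmf.prob (random_subset n q) {W. A \<subseteq> W} = q ^ card A"
proof -
  have "measure_pmf.prob (random_subset n q) {W. A \<subseteq> W}
      = measure_pmf.prob (Pi_pmf {0..n} False (\<lambda>_. bernoulli_pmf q))
          (Pi {0..n} (\<lambda>i. if i \<in> A then {True} else UNIV))"
    unfolding random_subset_def measure_map_pmf
    using assms(1) by (intro arg_cong[where f = "measure_pmf.prob _"]) (auto simp: Pi_iff subset_iff split: if_splits)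
  also have "\<dots> = (\<Prod>i\<in>{0..n}. if i \<in> A then q else 1)"
    using assms(2,3) by (subst measure_Pi_pmf_Pi) (auto intro!: prod.cong simp: measure_pmf_single)
  also have "\<dots> = q ^ card A"
    using assms(1) by (simp add: Int_absorb1 flip: prod.inter_restrict)
  finally show ?thesis .
qed

text \<open>Cauchy-Schwarz by completing a square: \<open>X\<close> has mean 1, second moment
  \<open>Q\<close> and vanishes off the family, so expanding the mean square of
  \<open>X - Q * indicator \<A>\<close> gives
  \<open>0 \<le> Q - 2 * Q + Q\<^sup>2 * mu n q \<A>\<close>.\<close>

lemma second_moment_bound:
  assumes mono: "monotone_family n \<A>"
    and M: "M \<subseteq> \<A>" and l1: "sum l M = 1" and q: "0 < q" "q \<le> 1"
    and Q: "Q = (\<Sum>A\<in>M. \<Sum>B\<in>M. l A * l B * (1 / q) ^ card (A \<inter> B))" and Q0: "Q > 0"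
  shows "mu n q \<A> \<ge> 1 / Q"
proof -
  let ?P = "random_subset n q"
  define X where "X W = (\<Sum>A\<in>M. l A / q ^ card A * indicator {W. A \<subseteq> W} W)" for W :: "nat set"
  have sub: "A \<subseteq> {0..n}" "finite A" if "A \<in> M" for A
    using that M mono finite_subset[of A "{0..n}"] by (auto simp: monotone_family_def)
  have int [simp]: "integrable (measure_pmf ?P) f" for f :: "nat set \<Rightarrow> real"
    by (intro integrable_measure_pmf_finite finite_set_pmf_random_subset)
  have EX: "measure_pmf.expectation ?P X = 1"
  proof -
    have "measure_pmf.expectation ?P X
        = (\<Sum>A\<in>M. l A / q ^ card A * measure_pmf.prob ?P {W. A \<subseteq> W})"
      unfolding X_def by simp
    also have "\<dots> = sum l M"
      using q sub by (intro sum.cong) (auto simp: prob_random_subset_superset)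
    finally show ?thesis using l1 by simp
  qed
  have EX2: "measure_pmf.expectation ?P (\<lambda>W. (X W)\<^sup>2) = Q"
  proof -
    have "(X W)\<^sup>2 = (\<Sum>A\<in>M. \<Sum>B\<in>M.
        l A / q ^ card A * (l B / q ^ card B) * indicator {W. A \<union> B \<subseteq> W} W)" for W
      unfolding X_def power2_eq_square sum_product
      by (intro sum.cong refl) (auto simp: indicator_def)
    then have "measure_pmf.expectation ?P (\<lambda>W. (X W)\<^sup>2) = (\<Sum>A\<in>M. \<Sum>B\<in>M.
        l A / q ^ card A * (l B / q ^ card B) * measure_pmf.prob ?P {W. A \<union> B \<subseteq> W})"
      by simp
    also have "\<dots> = Q"
      unfolding Q
    proof (intro sum.cong refl)
      fix A B assume AB: "A \<in> M" "B \<in> M"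
      \<comment> \<open>The probability of containing \<open>A \<union> B\<close>, divided by both
        normalising factors, leaves one factor \<open>1 / q\<close> for each element counted twice,
        that is, for each element of \<open>A \<inter> B\<close>.\<close>
      have "q ^ card A * q ^ card B = q ^ card (A \<union> B) * q ^ card (A \<inter> B)"
        using card_Un_Int[OF sub(2)[OF AB(1)] sub(2)[OF AB(2)]] by (simp flip: power_add)
      then show "l A / q ^ card A * (l B / q ^ card B) * measure_pmf.prob ?P {W. A \<union> B \<subseteq> W}
          = l A * l B * (1 / q) ^ card (A \<inter> B)"
        using q sub AB by (subst prob_random_subset_superset) (auto simp: field_simps)
    qed
    finally show ?thesis .
  qed
  \<comment> \<open>The restriction to the support matters: monotonicity speaks only of subsets of
    \<open>{0..n}\<close>, and a set reaching beyond that could contain some \<open>A\<close> in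
    \<open>M\<close> without belonging to the family.\<close>
  have X0: "X W * indicator \<A> W = X W" if "W \<in> set_pmf ?P" for W
  proof (cases "W \<in> \<A>")
    case False
    have "W \<subseteq> {0..n}" using that set_pmf_random_subset by blast
    then have "\<not> A \<subseteq> W" if "A \<in> M" for A
      using False that M mono unfolding monotone_family_def by (metis psubsetI subsetD)
    then show ?thesis using False by (simp add: X_def)
  qed simp
  have "0 \<le> measure_pmf.expectation ?P (\<lambda>W. (X W - Q * indicator \<A> W)\<^sup>2)"
    by (intro integral_nonneg_AE) auto
  also have "\<dots> = measure_pmf.expectation ?P
      (\<lambda>W. (X W)\<^sup>2 - 2 * Q * X W + Q\<^sup>2 * indicator \<A> W)"
  proof (intro integral_cong_AE AE_pmfI)
    fix W assume "W \<in> set_pmf ?P"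
    from X0[OF this] show "(X W - Q * indicator \<A> W)\<^sup>2
        = (X W)\<^sup>2 - 2 * Q * X W + Q\<^sup>2 * indicator \<A> W"
      by (cases "W \<in> \<A>") (auto simp: power2_eq_square algebra_simps)
  qed auto
  also have "\<dots> = Q - 2 * Q + Q\<^sup>2 * mu n q \<A>"
    by (simp add: EX EX2 mu_def)
  finally have "Q * 1 \<le> Q * (Q * mu n q \<A>)" by (simp add: power2_eq_square)
  then have "1 \<le> Q * mu n q \<A>" using Q0 by (simp only: mult_le_cancel_left_pos)
  then show ?thesis using Q0 by (simp add: field_simps)
qed

section \<open>From the minimiser to a fractional cover, and its cost\<close>

lemma frac_expectation_le_cover_cost:
  assumes "\<A> \<subseteq> Pow {0..n}" "p \<ge> 0" "fractional_cover n \<A> \<beta>"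
  shows "frac_expectation n p \<A> \<le> cover_cost n p \<beta>"
  using frac_expectation_attained[OF assms(1,2)] assms(3) by metis

theorem corollary2p5:
  fixes n k :: nat and p :: real and \<A> :: "nat set set"
  assumes "k > 0"
    and "monotone_family n \<A>"
    and "\<forall>A \<in> minterms \<A>. card A \<le> k"
    and "0 \<le> p" and "p \<le> 1"
    and "real k * p \<le> 1"
    and "frac_expectation n p \<A> = 1"
  shows "mu n (real k * p) \<A> > 1 / exp 1"
proof -
  have AP: "\<A> \<subseteq> Pow {0..n}" using assms(2) by (simp add: monotone_family_def)
  have cost: "1 \<le> cover_cost n p \<beta>" if "fractional_cover n \<A> \<beta>" for \<beta>
    using frac_expectation_le_cover_cost[OF AP assms(4) that] assms(7) by simp
  define M where "M = minterms \<A>"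
  have MA: "M \<subseteq> \<A>" by (auto simp: M_def minterms_def)
  have finM: "finite M" using MA AP finite_subset[of M "Pow {0..n}"] by auto
  have sub: "A \<subseteq> {0..n}" "finite A" if "A \<in> M" for A
    using that MA AP finite_subset[of A "{0..n}"] by auto
  \<comment> \<open>Without minterms the zero function would be a fractional cover of cost 0, below
    the minimum 1.\<close>
  have ne: "M \<noteq> {}"
    using cost[of "\<lambda>_. 0"] by (auto simp: fractional_cover_def cover_cost_def M_def)
  show ?thesis
  proof (cases "p = 0")
    case True
    \<comment> \<open>At \<open>p = 0\<close> nonempty sets are free, so this \<open>\<beta>\<close>
      costs 0 and still covers every nonempty minterm. As it cannot be a fractional cover, the empty
      set is a minterm and the family contains every subset of \<open>{0..n}\<close>.\<close>
    define \<beta> :: "nat set \<Rightarrow> real" where "\<beta> B = (if B = {} then 0 else 1)" for B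
    have \<beta>0: "0 \<le> \<beta> B" for B by (simp add: \<beta>_def)
    have "cover_cost n p \<beta> = 0"
      unfolding cover_cost_def
    proof (intro sum.neutral ballI)
      fix B assume "B \<in> Pow {0..n}"
      then have "finite B" by (auto intro: finite_subset)
      then show "\<beta> B * p ^ card B = 0"
        using True by (auto simp: \<beta>_def card_eq_0_iff)
    qed
    then have "\<not> fractional_cover n \<A> \<beta>" using cost by fastforce
    then obtain A where A: "A \<in> M" "\<not> (\<Sum>B\<in>Pow A. \<beta> B) \<ge> 1"
      by (auto simp: fractional_cover_def M_def \<beta>0)
    have "A = {}"
    proof (rule ccontr)
      assume "A \<noteq> {}"
      then have "\<beta> A = 1" by (simp add: \<beta>_def)
      moreover have "\<beta> A \<le> (\<Sum>B\<in>Pow A. \<beta> B)"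
        using sub[OF A(1)] by (intro member_le_sum) (auto simp: \<beta>0)
      ultimately show False using A(2) by simp
    qed
    then have "{} \<in> \<A>" using A(1) MA by auto
    then have "B \<in> \<A>" if "B \<subseteq> {0..n}" for B
      using assms(2) that unfolding monotone_family_def by (cases "B = {}") blast+
    then have "mu n (real k * p) \<A> = 1"
      unfolding mu_def using set_pmf_random_subset[of n "real k * p"]
      by (intro measure_pmf.prob_eq_1[THEN iffD2] AE_pmfI) auto
    then show ?thesis by simp
  next
    case False
    define q where "q = real k * p"
    have p: "p > 0" using False assms(4) by simp
    have q: "0 < q" "q \<le> 1" using p assms(1,6) by (auto simp: q_def)
    define K where "K A B = (1 / q) ^ card (A \<inter> B)" for A B :: "nat set"
    obtain l where l: "\<And>A. A \<in> M \<Longrightarrow> l A \<ge> 0" "sum l M = 1"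
      "\<And>A. A \<in> M \<Longrightarrow> (\<Sum>B\<in>M. \<Sum>C\<in>M. l B * l C * K B C) \<le> (\<Sum>B\<in>M. l B * K A B)"
      using simplex_quadratic_form_minimizer[OF finM ne, of K] by (auto simp: K_def Int_commute)
    define Q where "Q = (\<Sum>A\<in>M. \<Sum>B\<in>M. l A * l B * K A B)"
    have "1 = (\<Sum>A\<in>M. \<Sum>B\<in>M. l A * l B)"
      using l(2) by (simp flip: sum_product)
    also have "\<dots> \<le> Q"
      unfolding Q_def
    proof (intro sum_mono)
      fix A B assume "A \<in> M" "B \<in> M"
      then have "0 \<le> l A * l B" using l(1) by simp
      moreover have "1 \<le> K A B" using q by (simp add: K_def one_le_power)
      ultimately show "l A * l B \<le> l A * l B * K A B" by (simp add: mult_le_cancel_left1)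
    qed
    finally have Q1: "Q \<ge> 1" .
    \<comment> \<open>This \<open>x\<close> satisfies \<open>1 + x = 1 / q\<close>, so summing
      \<open>x ^ card S\<close> over all \<open>S \<subseteq> A \<inter> B\<close> gives
      \<open>K A B\<close>. Hence \<open>\<beta>\<close> below sums over the subsets of a minterm
      \<open>A\<close> to \<open>(\<Sum>B\<in>M. l B * K A B) / Q\<close>, which is at least 1 by
      the first-order condition.\<close>
    define x where "x = 1 / q - 1"
    have x0: "x \<ge> 0" using q by (simp add: x_def)
    define \<beta> where "\<beta> S = x ^ card S * (\<Sum>B\<in>M. if S \<subseteq> B then l B else 0) / Q" for S
    have "fractional_cover n \<A> \<beta>"
      unfolding fractional_cover_def
    proof (intro conjI ballI)
      fix S show "0 \<le> \<beta> S"
        using x0 Q1 l(1) by (auto simp: \<beta>_def intro!: divide_nonneg_nonneg mult_nonneg_nonneg sum_nonneg)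
    next
      fix A assume "A \<in> minterms \<A>"
      then have A: "A \<in> M" by (simp add: M_def)
      have "(\<Sum>S\<in>Pow A. \<beta> S) = (\<Sum>S\<in>Pow A. \<Sum>B\<in>M. if S \<subseteq> B then l B * x ^ card S else 0) / Q"
        unfolding \<beta>_def sum_divide_distrib[symmetric] sum_distrib_left
        by (intro arg_cong[where f = "\<lambda>y. y / Q"] sum.cong) auto
      also have "(\<Sum>S\<in>Pow A. \<Sum>B\<in>M. if S \<subseteq> B then l B * x ^ card S else 0)
          = (\<Sum>B\<in>M. \<Sum>S\<in>Pow A. if S \<subseteq> B then l B * x ^ card S else 0)"
        by (rule sum.swap)
      also have "\<dots> = (\<Sum>B\<in>M. l B * K A B)"
      proof (intro sum.cong refl)
        fix B
        have "(\<Sum>S\<in>Pow A. if S \<subseteq> B then l B * x ^ card S else 0)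
            = (\<Sum>S\<in>Pow (A \<inter> B). l B * x ^ card S)"
          using sub[OF A] by (intro sum.mono_neutral_cong_right) auto
        also have "\<dots> = l B * K A B"
          using sub[OF A] by (simp add: sum_Pow_power_card x_def K_def del: Pow_Int_eq flip: sum_distrib_left)
        finally show "(\<Sum>S\<in>Pow A. if S \<subseteq> B then l B * x ^ card S else 0) = l B * K A B" .
      qed
      finally show "1 \<le> (\<Sum>S\<in>Pow A. \<beta> S)"
        using l(3)[OF A] Q1 by (simp flip: Q_def)
    qed
    then have "1 \<le> cover_cost n p \<beta>" by (rule cost)
    \<comment> \<open>The same exchange of sums as for the covering condition; the factor
      \<open>p ^ card S\<close> merely replaces \<open>x\<close> by \<open>x * p\<close> in the
      binomial expansion.\<close>
    also have "cover_cost n p \<beta> = (\<Sum>B\<in>M. l B * (1 + x * p) ^ card B) / Q"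
    proof -
      have "cover_cost n p \<beta>
          = (\<Sum>S\<in>Pow {0..n}. \<Sum>B\<in>M. if S \<subseteq> B then l B * (x * p) ^ card S else 0) / Q"
        unfolding cover_cost_def \<beta>_def sum_divide_distrib times_divide_eq_left
          sum_distrib_left sum_distrib_right
        by (intro sum.cong refl) (auto simp: power_mult_distrib)
      also have "(\<Sum>S\<in>Pow {0..n}. \<Sum>B\<in>M. if S \<subseteq> B then l B * (x * p) ^ card S else 0)
          = (\<Sum>B\<in>M. \<Sum>S\<in>Pow {0..n}. if S \<subseteq> B then l B * (x * p) ^ card S else 0)"
        by (rule sum.swap)
      also have "\<dots> = (\<Sum>B\<in>M. l B * (1 + x * p) ^ card B)"
      proof (intro sum.cong refl)
        fix B assume B: "B \<in> M"
        have "(\<Sum>S\<in>Pow {0..n}. if S \<subseteq> B then l B * (x * p) ^ card S else 0)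
            = (\<Sum>S\<in>Pow B. l B * (x * p) ^ card S)"
          using sub[OF B] by (intro sum.mono_neutral_cong_right) auto
        then show "(\<Sum>S\<in>Pow {0..n}. if S \<subseteq> B then l B * (x * p) ^ card S else 0)
            = l B * (1 + x * p) ^ card B"
          using sub[OF B] by (simp add: sum_Pow_power_card flip: sum_distrib_left)
      qed
      finally show ?thesis .
    qed
    finally have "Q \<le> (\<Sum>B\<in>M. l B * (1 + x * p) ^ card B)"
      using Q1 by (simp add: field_simps)
    also have "\<dots> \<le> (\<Sum>B\<in>M. l B * (1 + x * p) ^ k)"
      using l(1) assms(3) x0 p
      by (intro sum_mono mult_left_mono power_increasing) (auto simp: M_def)
    also have "\<dots> = (1 + x * p) ^ k"
      using l(2) by (simp flip: sum_distrib_right)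
    also have "\<dots> \<le> exp (x * p) ^ k"
      using x0 p by (intro power_mono exp_ge_add_one_self) auto
    \<comment> \<open>Since \<open>q = k * p\<close>, the exponent is
      \<open>k * x * p = q * (1 / q - 1) = 1 - q\<close>; the strict inequality of the conclusion
      then comes from \<open>q > 0\<close>.\<close>
    also have "\<dots> = exp (1 - q)"
      using p assms(1) by (simp add: x_def q_def field_simps flip: exp_of_nat_mult)
    also have "\<dots> < exp 1" using q by simp
    finally have "1 / exp 1 < 1 / Q" using Q1 by (intro divide_strict_left_mono) auto
    also have "1 / Q \<le> mu n q \<A>"
      using Q1 by (intro second_moment_bound[OF assms(2) MA l(2) q]) (auto simp: Q_def K_def)
    finally show ?thesis by (simp add: q_def)
  qed
qed

end
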